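(* Fix an integer $r\ge2$ and a collection of non-negative integers $\boldsymbol\ell=\{\ell_{ij}\}_{1\le i<j\le r}$. Then $$1+\sum_{\boldsymbol n=(n_1,\dots,n_r)\in\mathbb{Z}_{\ge0}^r,\ \boldsymbol n\ne\boldsymbol0}(x-1)^{\kappa(\boldsymbol\ell,\boldsymbol n)}\,\mathrm{Tutte}\bigl(K^{(\boldsymbol\ell)}_{n_1,\dots,n_r},x,y\bigr)\frac{t_1^{n_1}}{n_1!}\cdots\frac{t_r^{n_r}}{n_r!}$$ $$=\left(\sum_{\boldsymbol m=(m_1,\dots,m_r)\in\mathbb{Z}_{\ge0}^r}y^{\sum_{1\le i<j\le r}\ell_{ij}m_im_j}(y-1)^{-|\boldsymbol m|}\frac{t_1^{m_1}}{m_1!}\cdots\frac{t_r^{m_r}}{m_r!}\right)^{(x-1)(y-1)},$$ where $\kappa(\boldsymbol\ell,\boldsymbol n)$ is the number of connected components of the graph $K^{(\boldsymbol\ell)}_{n_1,\dots,n_r}$.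
   Context: The $\boldsymbol\ell$-weighted complete multipartite graph $K^{(\boldsymbol\ell)}_{n_1,\dots,n_r}$ has vertex set the disjoint union of sets $S_1,\dots,S_r$ with $|S_j|=n_j$; for $i<j$, every $\alpha\in S_i$ and every $\beta\in S_j$ are joined by exactly $\ell_{ij}$ parallel edges, and there are no other edges. $\mathrm{Tutte}(\Gamma,x,y)=\sum_{A\subset E}(x-1)^{\kappa(A)-\kappa(E)}(y-1)^{\kappa(A)+|A|-|V|}$ is the Tutte polynomial of $\Gamma=(V,E)$ ($\kappa(A)$ is the number of connected components of $(V,A)$). $|\boldsymbol m|=m_1+\cdots+m_r$. The identity is one of formal power series in $t_1,\dots,t_r$; the power on the right is $\exp((x-1)(y-1)\log(\cdot))$, the base having constant term $1$. *)

theory Defs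
  imports "HOL-Computational_Algebra.Computational_Algebra"
begin

text \<open>With this instance, a field of type class \<open>field_char_0\<close> may be taken to be
  \<open>rat poly poly fract\<close>, the rational functions in two indeterminates.\<close>
instance fract :: ("{idom, ring_char_0}") field_char_0
proof
  show "inj (of_nat :: nat \<Rightarrow> 'a fract)"
    by (rule injI) (simp add: of_nat_fract eq_fract)
qed


section \<open>Formal power series in variables indexed by a finite type\<close>

typedef ('r, 'a) mfps = "UNIV :: (('r \<Rightarrow> nat) \<Rightarrow> 'a) set"
  morphisms mfps_nth Abs_mfps
  by simp

lemma mfps_nth_Abs [simp]: "mfps_nth (Abs_mfps f) = f"
  by (simp add: Abs_mfps_inverse)

lemma mfps_eqI: "(\<And>n. mfps_nth f n = mfps_nth g n) \<Longrightarrow> f = g"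
  by (metis ext mfps_nth_inject)

lemma finite_multiindex_le [simp]: "finite {k. k \<le> (n :: 'r::finite \<Rightarrow> nat)}"
proof -
  have "{k. k \<le> n} = (\<Pi>\<^sub>E i\<in>UNIV. {..n i})"
    by (auto simp: le_fun_def PiE_def extensional_def)
  then show ?thesis
    by (simp add: finite_PiE)
qed

instantiation mfps :: (finite, comm_ring_1) comm_ring_1
begin

definition zero_mfps :: "('a, 'b) mfps"
  where "0 = Abs_mfps (\<lambda>n. 0)"

definition one_mfps :: "('a, 'b) mfps"
  where "1 = Abs_mfps (\<lambda>n. if n = (\<lambda>i. 0) then 1 else 0)"

definition plus_mfps :: "('a, 'b) mfps \<Rightarrow> ('a, 'b) mfps \<Rightarrow> ('a, 'b) mfps"
  where "f + g = Abs_mfps (\<lambda>n. mfps_nth f n + mfps_nth g n)"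

definition uminus_mfps :: "('a, 'b) mfps \<Rightarrow> ('a, 'b) mfps"
  where "- f = Abs_mfps (\<lambda>n. - mfps_nth f n)"

definition minus_mfps :: "('a, 'b) mfps \<Rightarrow> ('a, 'b) mfps \<Rightarrow> ('a, 'b) mfps"
  where "f - g = Abs_mfps (\<lambda>n. mfps_nth f n - mfps_nth g n)"

definition times_mfps :: "('a, 'b) mfps \<Rightarrow> ('a, 'b) mfps \<Rightarrow> ('a, 'b) mfps"
  where "f * g = Abs_mfps (\<lambda>n. \<Sum>k | k \<le> n. mfps_nth f k * mfps_nth g (n - k))"

instance
proof
  fix a b c :: "('a, 'b) mfps"
  show "a * b * c = a * (b * c)"
  proof (rule mfps_eqI)
    fix n
    let ?f = "mfps_nth a" and ?g = "mfps_nth b" and ?h = "mfps_nth c"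
    have "mfps_nth (a * b * c) n =
        (\<Sum>(k, i)\<in>(SIGMA k:{k. k \<le> n}. {i. i \<le> k}). ?f i * ?g (k - i) * ?h (n - k))"
      by (simp add: times_mfps_def sum_distrib_right sum.Sigma)
    also have "\<dots> =
        (\<Sum>(i, j)\<in>(SIGMA i:{i. i \<le> n}. {j. j \<le> n - i}). ?f i * ?g j * ?h (n - i - j))"
      by (rule sum.reindex_bij_witness
            [where i = "\<lambda>(i, j). (\<lambda>s. i s + j s, i)" and j = "\<lambda>(k, i). (i, k - i)"])
         (auto simp: le_fun_def fun_diff_def add.commute diff_diff_left le_diff_conv2
           intro: diff_le_mono order_trans)
    also have "\<dots> = mfps_nth (a * (b * c)) n"
      by (simp add: times_mfps_def sum_distrib_left sum.Sigma mult.assoc)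
    finally show "mfps_nth (a * b * c) n = mfps_nth (a * (b * c)) n" .
  qed
  show "a * b = b * a"
  proof (rule mfps_eqI)
    fix n
    have "n - (n - k) = k" if "k \<le> n" for k :: "'a \<Rightarrow> nat"
      using that by (auto simp: le_fun_def)
    then show "mfps_nth (a * b) n = mfps_nth (b * a) n"
      unfolding times_mfps_def mfps_nth_Abs
      by (intro sum.reindex_bij_witness[where i = "\<lambda>k. n - k" and j = "\<lambda>k. n - k"])
         (auto simp: le_fun_def mult.commute)
  qed
  show "1 * a = a"
  proof (rule mfps_eqI)
    fix n
    have "mfps_nth (1 * a) n =
        (\<Sum>k | k \<le> n. if k = (\<lambda>i. 0) then mfps_nth a (n - k) else 0)"
      unfolding times_mfps_def one_mfps_def mfps_nth_Abs by (rule sum.cong) auto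
    also have "\<dots> = mfps_nth a n"
      by (subst sum.delta[OF finite_multiindex_le]) (auto simp: le_fun_def fun_diff_def)
    finally show "mfps_nth (1 * a) n = mfps_nth a n" .
  qed
  show "(a + b) * c = a * c + b * c"
    by (rule mfps_eqI) (simp add: times_mfps_def plus_mfps_def distrib_right sum.distrib)
  show "(0 :: ('a, 'b) mfps) \<noteq> 1"
    proof
    assume "(0 :: ('a, 'b) mfps) = 1"
    then have "mfps_nth (0 :: ('a, 'b) mfps) (\<lambda>i. 0) = mfps_nth 1 (\<lambda>i. 0)"
      by (rule arg_cong)
    then show False
      by (simp add: zero_mfps_def one_mfps_def)
  qed
qed (rule mfps_eqI;
     simp add: plus_mfps_def zero_mfps_def uminus_mfps_def minus_mfps_def algebra_simps)+

end

definition mfps_const :: "'a::zero \<Rightarrow> ('r, 'a) mfps"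
  where "mfps_const c = Abs_mfps (\<lambda>n. if n = (\<lambda>i. 0) then c else 0)"

text \<open>
  The substitution \<open>p(u) = (\<Sum>k. p\<^sub>k u\<^sup>k)\<close> of a series \<open>u\<close> with zero constant term into
  a univariate series. As \<open>u\<^sup>k\<close> has no term of total degree less than \<open>k\<close>, only \<open>k \<le> \<bar>n\<bar>\<close>
  contribute to the coefficient at \<open>n\<close>. The value is meaningless if \<open>u\<close> has a nonzero
  constant term.
\<close>
definition mfps_subst :: "'a::comm_ring_1 fps \<Rightarrow> ('r::finite, 'a) mfps \<Rightarrow> ('r, 'a) mfps"
  where "mfps_subst p u =
    Abs_mfps (\<lambda>n. \<Sum>k\<le>(\<Sum>i\<in>UNIV. n i). fps_nth p k * mfps_nth (u ^ k) n)"

definition mfps_exp :: "('r::finite, 'a::field_char_0) mfps \<Rightarrow> ('r, 'a) mfps"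
  where "mfps_exp u = mfps_subst (fps_exp 1) u"

text \<open>The library's \<open>fps_ln 1\<close> is the series of \<open>log (1 + X)\<close>, hence the shift by 1;
  \<open>f\<close> must have constant term 1.\<close>
definition mfps_log :: "('r::finite, 'a::field_char_0) mfps \<Rightarrow> ('r, 'a) mfps"
  where "mfps_log f = mfps_subst (fps_ln 1) (f - 1)"

definition mfps_powr :: "('r::finite, 'a::field_char_0) mfps \<Rightarrow> 'a \<Rightarrow> ('r, 'a) mfps"
  where "mfps_powr f c = mfps_exp (mfps_const c * mfps_log f)"


section \<open>Multigraphs and the Tutte polynomial\<close>

text \<open>Edges are abstract, so that parallel edges are distinct; \<open>ends e\<close> is the set of the
  one or two end points of \<open>e\<close>.\<close>
record ('v, 'e) multigraph =
  verts :: "'v set"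
  edges :: "'e set"
  ends :: "'e \<Rightarrow> 'v set"

definition adj :: "('v, 'e) multigraph \<Rightarrow> 'e set \<Rightarrow> ('v \<times> 'v) set"
  where "adj G A = {(u, v). \<exists>e\<in>A. ends G e = {u, v}}"

text \<open>The connected components of the spanning subgraph with edge set \<open>A\<close>.\<close>
definition components :: "('v, 'e) multigraph \<Rightarrow> 'e set \<Rightarrow> 'v set set"
  where "components G A = verts G // ((adj G A)\<^sup>* \<inter> verts G \<times> verts G)"

definition num_components :: "('v, 'e) multigraph \<Rightarrow> 'e set \<Rightarrow> nat"
  where "num_components G A = card (components G A)"

text \<open>For a finite graph and \<open>A \<subseteq> edges G\<close> both truncated subtractions in the exponents are
  exact: deleting edges does not decrease the number of components, and a spanning subgraph
  with \<open>k\<close> components has at least \<open>card (verts G) - k\<close> edges.\<close>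
definition Tutte :: "('v, 'e) multigraph \<Rightarrow> 'a::comm_ring_1 \<Rightarrow> 'a \<Rightarrow> 'a"
  where "Tutte G x y =
    (\<Sum>A\<in>Pow (edges G).
      (x - 1) ^ (num_components G A - num_components G (edges G)) *
      (y - 1) ^ (num_components G A + card A - card (verts G)))"

text \<open>The part \<open>S\<^sub>i\<close> is \<open>{i} \<times> {..<n i}\<close>; the edge \<open>(\<alpha>, \<beta>, k)\<close> is the \<open>k\<close>-th of the parallel
  edges between \<open>\<alpha>\<close> and \<open>\<beta>\<close>. Only the values \<open>l i j\<close> with \<open>i < j\<close> matter.\<close>
definition weighted_multipartite ::
    "('r::linorder \<Rightarrow> 'r \<Rightarrow> nat) \<Rightarrow> ('r \<Rightarrow> nat) \<Rightarrow>
      ('r \<times> nat, ('r \<times> nat) \<times> ('r \<times> nat) \<times> nat) multigraph"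
  where "weighted_multipartite l n =
    \<lparr>verts = {(i, a). a < n i},
     edges = {((i, a), (j, b), k) | i a j b k. i < j \<and> a < n i \<and> b < n j \<and> k < l i j},
     ends = (\<lambda>(\<alpha>, \<beta>, k). {\<alpha>, \<beta>})\<rparr>"

end

theory Submission
  imports Defs
begin

text \<open>
  Write \<open>v = y - 1\<close> and \<open>q = (x - 1) (y - 1)\<close>. Distributing the powers of \<open>x - 1\<close> and \<open>v\<close>
  turns the coefficient of \<open>t\<^sup>n / n!\<close> on the left into the Potts partition function
  \<open>v\<^sup>-\<^sup>|\<^sup>V\<^sup>| (\<Sum>A \<subseteq> E. q\<^sup>\<kappa>\<^sup>(\<^sup>A\<^sup>) v\<^sup>|\<^sup>A\<^sup>|)\<close> of the multipartite graph
  (\<open>Tutte_eq_cluster_sum\<close>), which is a polynomial in \<open>q\<close> once \<open>v\<close> is fixed.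

  Suppose first that \<open>q\<close> is a natural number. Then \<open>q\<^sup>\<kappa>\<^sup>(\<^sup>A\<^sup>)\<close> counts the \<open>q\<close>-colourings of
  the vertices that are constant on the edges in \<open>A\<close>, and exchanging the two sums gives the
  sum over all colourings of \<open>y\<close> to the number of monochromatic edges
  (\<open>Fortuin_Kasteleyn\<close>). In a multipartite graph that number depends only on how many
  vertices of each part carry each colour, and it is additive over the colours. So the sum is
  one over ordered partitions of the vertex set into \<open>q\<close> possibly empty blocks of a product
  of block weights, among which the factor \<open>v\<^sup>-\<^sup>|\<^sup>V\<^sup>|\<close> can be distributed as well, and its exponential generating function is the \<open>q\<close>-th power of that for a single
  block (\<open>nth_power_profile\<close>), which is the series on the right.

  For general \<open>q\<close>, the power of a series \<open>f\<close> with constant term 1 is the binomial series in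
  \<open>f - 1\<close> (\<open>mfps_powr_eq_subst_binomial\<close>). Hence each coefficient of the right-hand side is a
  polynomial in the exponent as well, and two polynomials that agree on the natural numbers
  are equal.
\<close>


section \<open>Substitution and powers of multivariate series\<close>

lemma mfps_nth_mult: "mfps_nth (f * g) n = (\<Sum>k | k \<le> n. mfps_nth f k * mfps_nth g (n - k))"
  by (simp add: times_mfps_def)

lemma mfps_nth_add: "mfps_nth (f + g) n = mfps_nth f n + mfps_nth g n"
  by (simp add: plus_mfps_def)

lemma mfps_nth_diff: "mfps_nth (f - g) n = mfps_nth f n - mfps_nth g n"
  by (simp add: minus_mfps_def)

lemma mfps_nth_1: "mfps_nth 1 n = (if n = (\<lambda>i. 0) then 1 else 0)"
  by (simp add: one_mfps_def)

lemma mfps_nth_const_mult: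
  "mfps_nth (mfps_const c * f) n = c * mfps_nth f n"
proof -
  have "mfps_nth (mfps_const c * f) n =
      (\<Sum>k | k \<le> n. if k = (\<lambda>i. 0) then c * mfps_nth f (n - k) else 0)"
    unfolding mfps_nth_mult mfps_const_def by (rule sum.cong) auto
  also have "\<dots> = c * mfps_nth f n"
    by (subst sum.delta[OF finite_multiindex_le]) (auto simp: le_fun_def fun_diff_def)
  finally show ?thesis .
qed

text \<open>Every factor of \<open>u\<^sup>k\<close> contributes at least 1 to the total degree.\<close>
lemma mfps_nth_power_eq_0:
  fixes u :: "('r::finite, 'a::comm_ring_1) mfps"
  assumes u: "mfps_nth u (\<lambda>i. 0) = 0" and "(\<Sum>i\<in>UNIV. n i) < k"
  shows "mfps_nth (u ^ k) n = 0"
  using assms(2)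
proof (induction k arbitrary: n)
  case (Suc k)
  have "mfps_nth u j * mfps_nth (u ^ k) (n - j) = 0" if "j \<le> n" for j
  proof (cases "j = (\<lambda>i. 0)")
    case False
    then obtain i where "j i > 0" by auto
    have "j i \<le> n i" using that by (simp add: le_fun_def)
    with \<open>j i > 0\<close> have "(\<Sum>i\<in>UNIV. (n - j) i) < (\<Sum>i\<in>UNIV. n i)"
      by (intro sum_strict_mono_ex1 ballI bexI[of _ i]) auto
    with Suc.prems show ?thesis
      by (simp add: Suc.IH)
  qed (simp add: u)
  then show ?case
    by (simp add: mfps_nth_mult)
qed simp

text \<open>The summation bound may be enlarged at will, so that coefficients at different
  multi-indices can be computed with a common bound.\<close>
lemma mfps_nth_subst:
  fixes u :: "('r::finite, 'a::comm_ring_1) mfps"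
  assumes u: "mfps_nth u (\<lambda>i. 0) = 0" and "(\<Sum>i\<in>UNIV. n i) \<le> N"
  shows "mfps_nth (mfps_subst p u) n = (\<Sum>k\<le>N. fps_nth p k * mfps_nth (u ^ k) n)"
  unfolding mfps_subst_def mfps_nth_Abs using assms(2)
  by (intro sum.mono_neutral_left) (auto simp: mfps_nth_power_eq_0[OF u])

lemma mfps_nth_subst_0:
  "mfps_nth (mfps_subst p u) (\<lambda>i. 0) = fps_nth p 0"
  by (simp add: mfps_subst_def mfps_nth_1)

text \<open>The convolution over multi-indices turns \<open>u\<^sup>a\<close> and \<open>u\<^sup>b\<close> into \<open>u\<^sup>a\<^sup>+\<^sup>b\<close>; the terms with
  \<open>a + b\<close> above the total degree vanish, and the rest is the univariate convolution.\<close>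
lemma mfps_subst_mult:
  fixes u :: "('r::finite, 'a::comm_ring_1) mfps"
  assumes u: "mfps_nth u (\<lambda>i. 0) = 0"
  shows "mfps_subst (p * q) u = mfps_subst p u * mfps_subst q u"
proof (rule mfps_eqI)
  fix n :: "'r \<Rightarrow> nat"
  define N where "N = (\<Sum>i\<in>UNIV. n i)"
  have le: "(\<Sum>i\<in>UNIV. k i) \<le> N" "(\<Sum>i\<in>UNIV. (n - k) i) \<le> N" if "k \<le> n" for k
    using that unfolding N_def by (auto intro!: sum_mono simp: le_fun_def)
  have supp: "k \<le> N" if "mfps_nth (u ^ k) n \<noteq> 0" for k
    using that mfps_nth_power_eq_0[OF u, of n k] unfolding N_def by (meson not_le)
  have "mfps_nth (mfps_subst p u * mfps_subst q u) n =
      (\<Sum>j | j \<le> n. (\<Sum>a\<le>N. fps_nth p a * mfps_nth (u ^ a) j) *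
        (\<Sum>b\<le>N. fps_nth q b * mfps_nth (u ^ b) (n - j)))"
    unfolding mfps_nth_mult
    by (intro sum.cong refl arg_cong2[where f = "(*)"] mfps_nth_subst[OF u] le) auto
  also have "\<dots> = (\<Sum>j | j \<le> n. \<Sum>a\<le>N. \<Sum>b\<le>N. fps_nth p a * fps_nth q b *
      (mfps_nth (u ^ a) j * mfps_nth (u ^ b) (n - j)))"
    by (simp add: sum_product ac_simps)
  also have "\<dots> = (\<Sum>a\<le>N. \<Sum>b\<le>N. \<Sum>j | j \<le> n. fps_nth p a * fps_nth q b *
      (mfps_nth (u ^ a) j * mfps_nth (u ^ b) (n - j)))"
    by (subst sum.swap, rule sum.cong[OF refl], subst sum.swap) simp
  also have "\<dots> = (\<Sum>a\<le>N. \<Sum>b\<le>N. fps_nth p a * fps_nth q b * mfps_nth (u ^ (a + b)) n)"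
    by (simp add: power_add mfps_nth_mult sum_distrib_left)
  also have "\<dots> = (\<Sum>(a, b)\<in>{..N} \<times> {..N}. fps_nth p a * fps_nth q b * mfps_nth (u ^ (a + b)) n)"
    by (simp add: sum.cartesian_product)
  also have "\<dots> = (\<Sum>(a, b)\<in>{(a, b). a + b \<le> N}. fps_nth p a * fps_nth q b * mfps_nth (u ^ (a + b)) n)"
    by (rule sum.mono_neutral_right) (auto, metis mult_zero_right supp)
  also have "\<dots> = (\<Sum>k\<le>N. fps_nth (p * q) k * mfps_nth (u ^ k) n)"
    by (subst sum.triangle_reindex_eq)
       (simp add: fps_mult_nth sum_distrib_right atLeast0AtMost)
  also have "\<dots> = mfps_nth (mfps_subst (p * q) u) n"
    by (simp add: mfps_nth_subst[OF u, of n N] N_def)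
  finally show "mfps_nth (mfps_subst (p * q) u) n = mfps_nth (mfps_subst p u * mfps_subst q u) n" ..
qed

lemma mfps_subst_1: "mfps_subst 1 u = 1"
proof (rule mfps_eqI)
  fix n :: "'a \<Rightarrow> nat"
  have "mfps_nth (mfps_subst 1 u) n =
      (\<Sum>k\<le>(\<Sum>i\<in>UNIV. n i). if k = 0 then mfps_nth 1 n else 0)"
    unfolding mfps_subst_def mfps_nth_Abs by (rule sum.cong) auto
  then show "mfps_nth (mfps_subst 1 u) n = mfps_nth 1 n"
    by simp
qed

lemma mfps_subst_power:
  assumes u: "mfps_nth u (\<lambda>i. 0) = 0"
  shows "mfps_subst (p ^ k) u = mfps_subst p u ^ k"
  by (induction k) (simp_all add: mfps_subst_1 mfps_subst_mult[OF u])

lemma mfps_subst_const_mult: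
  "mfps_subst (fps_const c * p) u = mfps_const c * mfps_subst p u"
  by (rule mfps_eqI) (simp add: mfps_nth_const_mult mfps_subst_def sum_distrib_left mult.assoc)

lemma mfps_subst_1_plus_X:
  fixes u :: "('r::finite, 'a::comm_ring_1) mfps"
  assumes u: "mfps_nth u (\<lambda>i. 0) = 0"
  shows "mfps_subst (1 + fps_X) u = 1 + u"
proof (rule mfps_eqI)
  fix n :: "'r \<Rightarrow> nat"
  define N where "N = (\<Sum>i\<in>UNIV. n i) + 1"
  have "mfps_nth (mfps_subst (1 + fps_X) u) n =
      (\<Sum>k\<le>N. fps_nth (1 + fps_X) k * mfps_nth (u ^ k) n)"
    by (rule mfps_nth_subst[OF u]) (simp add: N_def)
  also have "\<dots> = (\<Sum>k\<in>{0, 1}. fps_nth (1 + fps_X) k * mfps_nth (u ^ k) n)"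
    by (rule sum.mono_neutral_right) (auto simp: N_def)
  also have "\<dots> = mfps_nth (1 + u) n"
    by (simp add: mfps_nth_add)
  finally show "mfps_nth (mfps_subst (1 + fps_X) u) n = mfps_nth (1 + u) n" .
qed

text \<open>With \<open>mfps_subst_power\<close>, both sides expand to the double sum of
  \<open>p\<^sub>k (q\<^sup>k)\<^sub>j u\<^sup>j\<close>. The hypothesis on \<open>q\<close> makes the terms with \<open>k > j\<close> vanish, which are absent
  from the univariate composition.\<close>
lemma mfps_subst_compose:
  fixes u :: "('r::finite, 'a::comm_ring_1) mfps"
  assumes u: "mfps_nth u (\<lambda>i. 0) = 0" and q: "fps_nth q 0 = 0"
  shows "mfps_subst p (mfps_subst q u) = mfps_subst (p oo q) u"
proof (rule mfps_eqI)
  fix n :: "'r \<Rightarrow> nat"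
  define N where "N = (\<Sum>i\<in>UNIV. n i)"
  have comp: "fps_nth (p oo q) j = (\<Sum>k\<le>N. fps_nth p k * fps_nth (q ^ k) j)" if "j \<le> N" for j
    unfolding fps_compose_nth using that startsby_zero_power_prefix[OF q]
    by (intro sum.mono_neutral_left) auto
  have "mfps_nth (mfps_subst p (mfps_subst q u)) n =
      (\<Sum>k\<le>N. fps_nth p k * mfps_nth (mfps_subst (q ^ k) u) n)"
    by (simp add: mfps_nth_subst[of _ n N] mfps_nth_subst_0 q N_def mfps_subst_power[OF u])
  also have "\<dots> = (\<Sum>k\<le>N. \<Sum>j\<le>N. fps_nth p k * fps_nth (q ^ k) j * mfps_nth (u ^ j) n)"
    by (simp add: mfps_nth_subst[OF u, of n N] N_def sum_distrib_left mult.assoc)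
  also have "\<dots> = (\<Sum>j\<le>N. fps_nth (p oo q) j * mfps_nth (u ^ j) n)"
    by (subst sum.swap) (simp add: comp sum_distrib_right)
  also have "\<dots> = mfps_nth (mfps_subst (p oo q) u) n"
    by (simp add: mfps_nth_subst[OF u, of n N] N_def)
  finally show "mfps_nth (mfps_subst p (mfps_subst q u)) n = mfps_nth (mfps_subst (p oo q) u) n" .
qed

text \<open>By the chain rule the left-hand side satisfies \<open>(1 + X) F' = c F\<close> and \<open>F(0) = 1\<close>, which
  characterizes the binomial series.\<close>
lemma fps_exp_compose_const_mult_ln:
  "fps_exp 1 oo (fps_const c * fps_ln 1) = fps_binomial (c :: 'a::field_char_0)"
proof (rule iffD1[OF fps_binomial_ODE_unique'], rule conjI)
  let ?b = "fps_const c * fps_ln 1"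
  have "fps_deriv (fps_exp 1 oo ?b) = (fps_exp 1 oo ?b) * fps_deriv ?b"
    by (subst fps_compose_deriv) simp_all
  also have "fps_deriv ?b = fps_const c * inverse (1 + fps_X)"
    by (simp add: fps_ln_deriv)
  finally show "fps_deriv (fps_exp 1 oo ?b) = fps_const c * (fps_exp 1 oo ?b) / (1 + fps_X)"
    by (simp add: fps_divide_unit ac_simps)
qed simp

text \<open>This form of the power has no iterated substitution: the exponent enters only through
  binomial coefficients.\<close>
lemma mfps_powr_eq_subst_binomial:
  assumes f: "mfps_nth f (\<lambda>i. 0) = 1"
  shows "mfps_powr f c = mfps_subst (fps_binomial c) (f - 1)"
  using f by (simp add: mfps_powr_def mfps_exp_def mfps_log_def mfps_nth_diff mfps_nth_1
      mfps_subst_compose fps_exp_compose_const_mult_ln flip: mfps_subst_const_mult)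

lemma mfps_powr_of_nat:
  assumes f: "mfps_nth f (\<lambda>i. 0) = 1"
  shows "mfps_powr f (of_nat k) = f ^ k"
proof -
  have f1: "mfps_nth (f - 1) (\<lambda>i. 0) = 0"
    using f by (simp add: mfps_nth_diff mfps_nth_1)
  show ?thesis
    by (simp add: mfps_powr_eq_subst_binomial[OF f] fps_binomial_of_nat mfps_subst_power[OF f1]
        mfps_subst_1_plus_X[OF f1])
qed


section \<open>Polynomial dependence on the exponent\<close>

definition polynomial_function :: "('a::comm_ring_1 \<Rightarrow> 'a) \<Rightarrow> bool"
  where "polynomial_function f \<longleftrightarrow> (\<exists>p. f = poly p)"

lemma polynomial_function_const: "polynomial_function (\<lambda>x. c)"
  unfolding polynomial_function_def by (rule exI[of _ "[:c:]"]) auto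

lemma polynomial_function_ident: "polynomial_function (\<lambda>x. x)"
  unfolding polynomial_function_def by (rule exI[of _ "[:0, 1:]"]) auto

lemma polynomial_function_mult:
  "polynomial_function f \<Longrightarrow> polynomial_function g \<Longrightarrow> polynomial_function (\<lambda>x. f x * g x)"
  unfolding polynomial_function_def by (elim exE, rule_tac x = "p * pa" in exI) (simp add: fun_eq_iff)

lemma polynomial_function_power:
  "polynomial_function f \<Longrightarrow> polynomial_function (\<lambda>x. f x ^ k)"
  unfolding polynomial_function_def by (elim exE, rule_tac x = "p ^ k" in exI) (simp add: fun_eq_iff)

lemma polynomial_function_sum:
  assumes "\<And>a. a \<in> S \<Longrightarrow> polynomial_function (f a)"
  shows "polynomial_function (\<lambda>x. \<Sum>a\<in>S. f a x)"
proof -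
  from assms obtain p where "\<And>a. a \<in> S \<Longrightarrow> f a = poly (p a)"
    unfolding polynomial_function_def by metis
  then show ?thesis
    unfolding polynomial_function_def
    by (intro exI[of _ "\<Sum>a\<in>S. p a"]) (auto simp: poly_sum)
qed

lemma polynomial_function_gbinomial:
  "polynomial_function (\<lambda>x :: 'a::field_char_0. x gchoose k)"
proof -
  have "(\<lambda>x. x gchoose k) = poly (smult (inverse (fact k)) (\<Prod>i<k. [:- of_nat i, 1:]))"
    by (auto simp: gbinomial_prod_rev poly_prod atLeast0LessThan divide_inverse)
  then show ?thesis
    unfolding polynomial_function_def by blast
qed

text \<open>The difference would otherwise be a nonzero polynomial that has all natural numbers as
  roots.\<close>
lemma polynomial_function_eqI:
  fixes f g :: "'a::field_char_0 \<Rightarrow> 'a"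
  assumes "polynomial_function f" "polynomial_function g"
    and eq: "\<And>k. f (of_nat k) = g (of_nat k)"
  shows "f = g"
proof -
  obtain p q where pq: "f = poly p" "g = poly q"
    using assms(1,2) by (auto simp: polynomial_function_def)
  have "range of_nat \<subseteq> {x. poly (p - q) x = 0}"
    using eq by (auto simp: pq)
  moreover have "infinite (range (of_nat :: nat \<Rightarrow> 'a))"
    by (simp add: range_inj_infinite inj_of_nat)
  ultimately have "p - q = 0"
    using poly_roots_finite finite_subset by blast
  then show ?thesis
    by (simp add: pq)
qed

lemma polynomial_function_nth_powr:
  assumes f: "mfps_nth f (\<lambda>i. 0) = 1"
  shows "polynomial_function (\<lambda>c. mfps_nth (mfps_powr f c) n)"
  unfolding mfps_powr_eq_subst_binomial[OF f] mfps_subst_def mfps_nth_Abs fps_binomial_nth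
  by (intro polynomial_function_sum polynomial_function_mult polynomial_function_gbinomial
      polynomial_function_const)


section \<open>Colourings and components\<close>

definition constant_on_edges :: "('v, 'e) multigraph \<Rightarrow> ('v \<Rightarrow> 'c) \<Rightarrow> 'e set"
  where "constant_on_edges G c = {e \<in> edges G. \<forall>u\<in>ends G e. \<forall>w\<in>ends G e. c u = c w}"

lemma constant_on_edgesD:
  "e \<in> constant_on_edges G c \<Longrightarrow> u \<in> ends G e \<Longrightarrow> w \<in> ends G e \<Longrightarrow> c u = c w"
  unfolding constant_on_edges_def by blast

definition finite_multigraph :: "('v, 'e) multigraph \<Rightarrow> bool"
  where "finite_multigraph G \<longleftrightarrow> finite (verts G) \<and> finite (edges G) \<and>
    (\<forall>e\<in>edges G. \<exists>u\<in>verts G. \<exists>w\<in>verts G. ends G e = {u, w})"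

lemma equiv_connected:
  "equiv (verts G) ((adj G A)\<^sup>* \<inter> verts G \<times> verts G)"
proof -
  have "sym ((adj G A)\<^sup>*)"
    by (rule sym_rtrancl) (auto simp: sym_def adj_def insert_commute)
  then show ?thesis
    by (auto simp: equiv_def refl_on_def sym_def intro!: transI dest: rtrancl_trans)
qed

text \<open>The colourings that are constant on the edges in \<open>A\<close> are those that are constant along
  paths, hence the maps from the set of components to the colours.\<close>
lemma card_colourings:
  assumes G: "finite_multigraph G" and A: "A \<subseteq> edges G"
  shows "card {c \<in> verts G \<rightarrow>\<^sub>E Q. A \<subseteq> constant_on_edges G c} = card Q ^ num_components G A"
proof -
  define V where "V = verts G"
  define r where "r = (adj G A)\<^sup>* \<inter> V \<times> V"
  have r: "equiv V r"
    unfolding r_def V_def by (rule equiv_connected)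
  have fin: "finite (V // r)"
    using G by (simp add: finite_quotient r_def finite_multigraph_def V_def)
  have const: "c u = c w" if "A \<subseteq> constant_on_edges G c" "(u, w) \<in> (adj G A)\<^sup>*" for c :: "'a \<Rightarrow> 'c" and u w
    using that(2)
  proof (induction rule: rtrancl_induct)
    case (step s t)
    then obtain e where e: "e \<in> A" "ends G e = {s, t}"
      by (auto simp: adj_def)
    then have "e \<in> constant_on_edges G c"
      using that(1) by blast
    then have "c s = c t"
      by (rule constant_on_edgesD) (simp_all add: e)
    with step.IH show ?case
      by (rule trans)
  qed simp
  let ?S = "{c \<in> V \<rightarrow>\<^sub>E Q. A \<subseteq> constant_on_edges G c}"
  \<comment> \<open>The classes of \<open>r\<close> are the components: \<open>?f\<close> spreads colours of components over the
    vertices, and \<open>?g\<close> reads off the colour of a component at a representative.\<close>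
  let ?f = "\<lambda>d. \<lambda>u\<in>V. d (r `` {u})"
  let ?g = "\<lambda>c. \<lambda>C\<in>V // r. c (SOME u. u \<in> C)"
  have some: "(SOME w. w \<in> r `` {u}) \<in> r `` {u}" if "u \<in> V" for u
    using equiv_class_self[OF r that] by (rule someI)
  have cls: "r `` {u} = r `` {w}" if "(u, w) \<in> r" for u w
    using r that by (rule equiv_class_eq)
  have "bij_betw ?f (V // r \<rightarrow>\<^sub>E Q) ?S"
  proof (rule bij_betwI[where g = ?g])
    show "?f \<in> (V // r \<rightarrow>\<^sub>E Q) \<rightarrow> ?S"
    proof
      fix d assume d: "d \<in> V // r \<rightarrow>\<^sub>E Q"
      have "e \<in> constant_on_edges G (?f d)" if "e \<in> A" for e
      proof -
        from that A have "e \<in> edges G" by blast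
        with G obtain u w where uw: "u \<in> V" "w \<in> V" "ends G e = {u, w}"
          by (auto simp: finite_multigraph_def V_def)
        with that have "(u, w) \<in> r"
          by (auto simp: r_def adj_def)
        from cls[OF this] uw \<open>e \<in> edges G\<close> show ?thesis
          by (auto simp: constant_on_edges_def)
      qed
      with d show "?f d \<in> ?S"
        by (auto simp: PiE_iff quotientI)
    qed
    show "?g \<in> ?S \<rightarrow> (V // r \<rightarrow>\<^sub>E Q)"
    proof
      fix c assume c: "c \<in> ?S"
      have "(SOME w. w \<in> C) \<in> V" if "C \<in> V // r" for C
        using that some by (auto elim!: quotientE simp: r_def)
      with c show "?g c \<in> V // r \<rightarrow>\<^sub>E Q"
        by (auto simp: PiE_iff)
    qed
    show "?g (?f d) = d" if d: "d \<in> V // r \<rightarrow>\<^sub>E Q" for d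
    proof
      fix C
      show "?g (?f d) C = d C"
      proof (cases "C \<in> V // r")
        case True
        then obtain u where u: "u \<in> V" "C = r `` {u}" by (auto elim: quotientE)
        define w where "w = (SOME w. w \<in> C)"
        from some[OF u(1)] have uw: "(u, w) \<in> r"
          by (simp add: w_def u(2))
        then have "w \<in> V"
          by (simp add: r_def)
        moreover have "r `` {w} = C"
          using cls[OF uw] u(2) by simp
        ultimately have "?f d w = d C"
          by simp
        with True show ?thesis
          by (simp only: restrict_apply' w_def)
      qed (use d in \<open>auto simp: PiE_iff extensional_def\<close>)
    qed
    show "?f (?g c) = c" if c: "c \<in> ?S" for c
    proof
      fix u
      show "?f (?g c) u = c u"
      proof (cases "u \<in> V")
        case True
        with some[of u] have "(u, SOME w. w \<in> r `` {u}) \<in> (adj G A)\<^sup>*"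
          by (auto simp: r_def)
        moreover have "A \<subseteq> constant_on_edges G c"
          using c by simp
        ultimately have "c u = c (SOME w. w \<in> r `` {u})"
          by (intro const)
        with True show ?thesis
          by (simp only: restrict_apply' quotientI)
      qed (use c in \<open>auto simp: PiE_iff extensional_def\<close>)
    qed
  qed
  then have "card ?S = card (V // r \<rightarrow>\<^sub>E Q)"
    by (simp add: bij_betw_same_card)
  also have "\<dots> = card Q ^ num_components G A"
    using fin by (simp add: card_funcsetE num_components_def components_def r_def V_def)
  finally show ?thesis
    by (simp add: V_def)
qed

lemma finite_colourings:
  assumes "finite_multigraph G" "finite Q"
  shows "finite {c \<in> verts G \<rightarrow>\<^sub>E Q. P c}"
  using assms by (auto simp: finite_multigraph_def intro!: finite_subset[OF _ finite_PiE[of "verts G" "\<lambda>_. Q"]])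

text \<open>More edges leave fewer 2-colourings, and by \<open>card_colourings\<close> their number is a power
  of 2 with the number of components as exponent.\<close>
lemma num_components_antimono:
  assumes G: "finite_multigraph G" and "A \<subseteq> B" "B \<subseteq> edges G"
  shows "num_components G B \<le> num_components G A"
proof -
  have "card {c \<in> verts G \<rightarrow>\<^sub>E (UNIV :: bool set). B \<subseteq> constant_on_edges G c}
      \<le> card {c \<in> verts G \<rightarrow>\<^sub>E (UNIV :: bool set). A \<subseteq> constant_on_edges G c}"
    using \<open>A \<subseteq> B\<close> by (intro card_mono finite_colourings[OF G]) auto
  then have "(2::nat) ^ num_components G B \<le> 2 ^ num_components G A"
    using assms by (simp add: card_colourings del: One_nat_def)
  then show ?thesis
    by simp
qed

text \<open>In terms of 2-colourings: at least half of those that are constant on \<open>A\<close> are constant on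
  \<open>e\<close> too. Indeed, adding (modulo 2) one fixed colouring that is constant on \<open>A\<close>
  but not on \<open>e\<close> maps all such colourings injectively to those that are constant on both.\<close>
lemma num_components_insert_edge:
  assumes G: "finite_multigraph G" and A: "insert e A \<subseteq> edges G"
  shows "num_components G A \<le> num_components G (insert e A) + 1"
proof -
  define S where "S B = {c \<in> verts G \<rightarrow>\<^sub>E (UNIV :: bool set). B \<subseteq> constant_on_edges G c}" for B
  have card_S: "card (S B) = 2 ^ num_components G B" if "B \<subseteq> edges G" for B
    using card_colourings[OF G that, of "UNIV :: bool set"] by (simp add: S_def)
  have fin: "finite (S B)" for B
    unfolding S_def by (rule finite_colourings[OF G]) simp
  have sub: "S (insert e A) \<subseteq> S A"
    by (auto simp: S_def)
  have "card (S A - S (insert e A)) \<le> card (S (insert e A))"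
  proof (cases "S A - S (insert e A) = {}")
    case False
    then obtain c0 where c0: "c0 \<in> S A" "c0 \<notin> S (insert e A)" by blast
    define flip where "flip c = (\<lambda>u\<in>verts G. c u \<noteq> c0 u)" for c
    from A G obtain u w where e: "e \<in> edges G" "ends G e = {u, w}" "u \<in> verts G" "w \<in> verts G"
      by (auto simp: finite_multigraph_def)
    have in_verts: "ends G e' \<subseteq> verts G" if "e' \<in> edges G" for e'
      using that G by (auto simp: finite_multigraph_def)
    have differ: "c u \<noteq> c w" if "c \<in> S A" "c \<notin> S (insert e A)" for c
    proof
      assume "c u = c w"
      with e have "e \<in> constant_on_edges G c"
        by (simp add: constant_on_edges_def)
      with that show False
        by (simp add: S_def)
    qed
    have "flip c \<in> S (insert e A)" if c: "c \<in> S A" "c \<notin> S (insert e A)" for c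
    proof -
      have "e' \<in> constant_on_edges G (flip c)" if "e' \<in> A" for e'
      proof -
        have "e' \<in> constant_on_edges G c" "e' \<in> constant_on_edges G c0"
          using that c c0 by (auto simp: S_def)
        then have "e' \<in> edges G"
          and "\<And>s t. s \<in> ends G e' \<Longrightarrow> t \<in> ends G e' \<Longrightarrow> c s = c t \<and> c0 s = c0 t"
          unfolding constant_on_edges_def by blast+
        moreover from this(1) have "flip c s = (c s \<noteq> c0 s)" if "s \<in> ends G e'" for s
          using in_verts that by (auto simp: flip_def)
        ultimately show ?thesis
          unfolding constant_on_edges_def by blast
      qed
      moreover have "e \<in> constant_on_edges G (flip c)"
      proof -
        have "flip c u = flip c w"
          using differ[OF c] differ[OF c0] e(3,4) by (auto simp: flip_def)
        with e(1,2) show ?thesis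
          by (simp add: constant_on_edges_def)
      qed
      ultimately show ?thesis
        by (auto simp: S_def flip_def)
    qed
    moreover have "inj_on flip (S A)"
    proof (rule inj_onI)
      fix c c' assume *: "c \<in> S A" "c' \<in> S A" "flip c = flip c'"
      have "c t = c' t" if "t \<in> verts G" for t
        using fun_cong[OF *(3), of t] that by (auto simp: flip_def)
      moreover have "c \<in> verts G \<rightarrow>\<^sub>E UNIV" "c' \<in> verts G \<rightarrow>\<^sub>E UNIV"
        using * by (simp_all add: S_def)
      ultimately show "c = c'"
        by (intro PiE_ext)
    qed
    ultimately show ?thesis
      by (intro card_inj_on_le[of flip]) (auto intro: fin inj_on_subset)
  next
    case True
    then show ?thesis
      by (simp only: card.empty le0)
  qed
  then have "card (S A) \<le> 2 * card (S (insert e A))"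
    using sub fin by (simp add: card_Diff_subset)
  then have "(2::nat) ^ num_components G A \<le> 2 ^ (num_components G (insert e A) + 1)"
    using A by (simp add: card_S)
  then show ?thesis
    by (simp only: power_increasing_iff one_less_numeral_iff semiring_norm)
qed

lemma num_components_empty: "num_components G {} = card (verts G)"
proof -
  have "components G {} = (\<lambda>u. {u}) ` verts G"
    by (auto simp: components_def adj_def quotient_def)
  then show ?thesis
    by (simp add: num_components_def card_image)
qed

lemma card_verts_le:
  assumes G: "finite_multigraph G" and A: "A \<subseteq> edges G"
  shows "card (verts G) \<le> num_components G A + card A"
proof -
  have "finite A"
    using G A by (auto simp: finite_multigraph_def dest: finite_subset)
  then show ?thesis
    using A
  proof (induction A rule: finite_induct)
    case (insert e A)
    then show ?case
      using num_components_insert_edge[OF G, of e A] by simp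
  qed (simp add: num_components_empty)
qed

text \<open>The inequalities \<open>num_components_antimono\<close> and \<open>card_verts_le\<close> make the truncated
  subtractions in the exponents of the Tutte polynomial exact.\<close>
lemma Tutte_eq_cluster_sum:
  fixes x y :: "'a::field"
  assumes G: "finite_multigraph G" and "y \<noteq> 1"
  shows "(x - 1) ^ num_components G (edges G) * Tutte G x y =
    (\<Sum>A\<in>Pow (edges G). ((x - 1) * (y - 1)) ^ num_components G A * (y - 1) ^ card A)
      / (y - 1) ^ card (verts G)"
proof -
  have "(x - 1) ^ num_components G (edges G) *
      ((x - 1) ^ (num_components G A - num_components G (edges G)) *
       (y - 1) ^ (num_components G A + card A - card (verts G))) =
      ((x - 1) * (y - 1)) ^ num_components G A * (y - 1) ^ card A / (y - 1) ^ card (verts G)"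
    if A: "A \<in> Pow (edges G)" for A
  proof -
    have "(x - 1) ^ num_components G (edges G) *
        (x - 1) ^ (num_components G A - num_components G (edges G)) = (x - 1) ^ num_components G A"
      using A num_components_antimono[OF G, of A "edges G"] by (simp flip: power_add)
    moreover have "(y - 1) ^ (num_components G A + card A - card (verts G)) =
        (y - 1) ^ num_components G A * (y - 1) ^ card A / (y - 1) ^ card (verts G)"
      using \<open>y \<noteq> 1\<close> A card_verts_le[OF G, of A] by (simp add: power_diff power_add)
    ultimately show ?thesis
      by (simp add: power_mult_distrib flip: mult.assoc)
  qed
  then show ?thesis
    by (simp add: Tutte_def sum_distrib_left sum_divide_distrib)
qed

lemma sum_Pow_power_card:
  fixes v :: "'a::comm_ring_1"
  assumes "finite M"
  shows "(\<Sum>A\<in>Pow M. v ^ card A) = (1 + v) ^ card M"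
  using prod_add[OF assms, of "\<lambda>_. v" "\<lambda>_. 1"] by (simp add: add.commute)

text \<open>Replace \<open>card Q ^ num_components G A\<close> by a sum over colourings and exchange the sums. For
  a fixed colouring, \<open>A\<close> then runs over all sets of monochromatic edges.\<close>
lemma Fortuin_Kasteleyn:
  fixes v :: "'a::comm_ring_1"
  assumes G: "finite_multigraph G" and Q: "finite Q"
  shows "(\<Sum>A\<in>Pow (edges G). of_nat (card Q) ^ num_components G A * v ^ card A) =
    (\<Sum>c\<in>verts G \<rightarrow>\<^sub>E Q. (1 + v) ^ card (constant_on_edges G c))"
proof -
  let ?C = "verts G \<rightarrow>\<^sub>E Q"
  have fin: "finite ?C" "finite (edges G)"
    using G Q by (auto simp: finite_multigraph_def intro: finite_PiE)
  have "(\<Sum>A\<in>Pow (edges G). of_nat (card Q) ^ num_components G A * v ^ card A) =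
      (\<Sum>A\<in>Pow (edges G). \<Sum>c\<in>?C. if A \<subseteq> constant_on_edges G c then v ^ card A else 0)"
  proof (rule sum.cong[OF refl])
    fix A assume "A \<in> Pow (edges G)"
    then have "of_nat (card Q) ^ num_components G A =
        (of_nat (card {c \<in> ?C. A \<subseteq> constant_on_edges G c}) :: 'a)"
      using G by (simp add: card_colourings)
    then show "of_nat (card Q) ^ num_components G A * v ^ card A =
        (\<Sum>c\<in>?C. if A \<subseteq> constant_on_edges G c then v ^ card A else 0)"
      using fin by (simp add: sum.inter_filter[symmetric])
  qed
  also have "\<dots> = (\<Sum>c\<in>?C. \<Sum>A\<in>Pow (edges G). if A \<subseteq> constant_on_edges G c then v ^ card A else 0)"
    by (rule sum.swap)
  also have "\<dots> = (\<Sum>c\<in>?C. (1 + v) ^ card (constant_on_edges G c))"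
  proof (rule sum.cong[OF refl])
    fix c assume "c \<in> ?C"
    have sub: "constant_on_edges G c \<subseteq> edges G"
      by (auto simp: constant_on_edges_def)
    then have "(\<Sum>A\<in>Pow (edges G). if A \<subseteq> constant_on_edges G c then v ^ card A else 0) =
        (\<Sum>A\<in>Pow (constant_on_edges G c). v ^ card A)"
      using fin by (intro sum.mono_neutral_cong_right) auto
    then show "(\<Sum>A\<in>Pow (edges G). if A \<subseteq> constant_on_edges G c then v ^ card A else 0) =
        (1 + v) ^ card (constant_on_edges G c)"
      using finite_subset[OF sub fin(2)] by (simp add: sum_Pow_power_card)
  qed
  finally show ?thesis .
qed


section \<open>Sums over coloured vertex sets\<close>

text \<open>The parts of the vertex set are the fibres of the first projection.\<close>
definition profile :: "('r \<times> 'b) set \<Rightarrow> 'r \<Rightarrow> nat"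
  where "profile U i = card (U `` {i})"

lemma profile_mono: "finite U \<Longrightarrow> S \<subseteq> U \<Longrightarrow> profile S \<le> profile U"
  unfolding profile_def le_fun_def by (auto intro!: card_mono finite_Image)

lemma profile_Diff:
  assumes "finite U" "S \<subseteq> U"
  shows "profile (U - S) = profile U - profile S"
proof
  fix i
  have "(U - S) `` {i} = U `` {i} - S `` {i}" by auto
  then show "profile (U - S) i = (profile U - profile S) i"
    unfolding profile_def using assms
    by (simp add: card_Diff_subset Image_mono finite_subset)
qed

lemma sum_profile:
  fixes U :: "('r::finite \<times> 'b) set"
  assumes "finite U"
  shows "(\<Sum>i\<in>UNIV. profile U i) = card U"
proof -
  have "U = (SIGMA i:UNIV. U `` {i})" by auto
  then have "card U = card (SIGMA i:UNIV. U `` {i})" by simp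
  then show ?thesis
    using assms by (simp add: profile_def card_SigmaI)
qed

text \<open>A subset is chosen independently in each part.\<close>
lemma card_subsets_with_profile:
  fixes U :: "('r::finite \<times> 'b) set"
  assumes U: "finite U"
  shows "card {S. S \<subseteq> U \<and> profile S = k} = (\<Prod>i\<in>UNIV. profile U i choose k i)"
proof -
  let ?T = "\<Pi>\<^sub>E i\<in>UNIV. {X. X \<subseteq> U `` {i} \<and> card X = k i}"
  have "bij_betw (\<lambda>S i. S `` {i}) {S. S \<subseteq> U \<and> profile S = k} ?T"
  proof (rule bij_betwI[where g = "Sigma UNIV"])
    show "(\<lambda>S i. S `` {i}) \<in> {S. S \<subseteq> U \<and> profile S = k} \<rightarrow> ?T"
      by (auto simp: profile_def)
    show "Sigma UNIV \<in> ?T \<rightarrow> {S. S \<subseteq> U \<and> profile S = k}"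
    proof
      fix X assume X: "X \<in> ?T"
      have "Sigma UNIV X `` {i} = X i" for i by auto
      moreover have "X i \<subseteq> U `` {i}" "card (X i) = k i" for i
        using X by (auto simp: PiE_iff)
      ultimately show "Sigma UNIV X \<in> {S. S \<subseteq> U \<and> profile S = k}"
        by (auto simp: profile_def fun_eq_iff)
    qed
  qed auto
  then have "card {S. S \<subseteq> U \<and> profile S = k} = card ?T"
    by (rule bij_betw_same_card)
  also have "\<dots> = (\<Prod>i\<in>UNIV. profile U i choose k i)"
    by (simp add: card_PiE n_subsets finite_Image U profile_def)
  finally show ?thesis .
qed

text \<open>The product of exponential generating functions distributes a labelled set over two
  blocks: grouping the subsets \<open>S\<close> by their profile \<open>k\<close> produces the binomial coefficients
  that turn into the quotients of factorials.\<close>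
lemma nth_mult_profile:
  fixes g h :: "('r::finite \<Rightarrow> nat) \<Rightarrow> 'a::field_char_0" and U :: "('r \<times> 'b) set"
  assumes U: "finite U"
  shows "mfps_nth (Abs_mfps (\<lambda>m. g m / (\<Prod>i\<in>UNIV. fact (m i))) *
      Abs_mfps (\<lambda>m. h m / (\<Prod>i\<in>UNIV. fact (m i)))) (profile U) =
    (\<Sum>S\<in>Pow U. g (profile S) * h (profile (U - S))) / (\<Prod>i\<in>UNIV. fact (profile U i))"
proof -
  let ?n = "profile U"
  have "(\<Sum>S\<in>Pow U. g (profile S) * h (profile (U - S))) =
      (\<Sum>S\<in>Pow U. g (profile S) * h (?n - profile S))"
    by (intro sum.cong refl) (auto simp: profile_Diff U)
  also have "\<dots> = (\<Sum>k | k \<le> ?n. \<Sum>S | S \<in> Pow U \<and> profile S = k. g (profile S) * h (?n - profile S))"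
    using U by (intro sum.group[symmetric]) (auto simp: profile_mono)
  also have "\<dots> = (\<Sum>k | k \<le> ?n. (\<Prod>i\<in>UNIV. of_nat (?n i choose k i)) * (g k * h (?n - k)))"
    by (intro sum.cong refl) (simp add: card_subsets_with_profile[OF U])
  also have "\<dots> / (\<Prod>i\<in>UNIV. fact (?n i)) = (\<Sum>k | k \<le> ?n.
      (g k / (\<Prod>i\<in>UNIV. fact (k i))) * (h (?n - k) / (\<Prod>i\<in>UNIV. fact ((?n - k) i))))"
    unfolding sum_divide_distrib
  proof (intro sum.cong refl)
    fix k assume "k \<in> {k. k \<le> ?n}"
    then have "(of_nat (?n i choose k i) :: 'a) = fact (?n i) / (fact (k i) * fact ((?n - k) i))" for i
      by (simp add: binomial_fact le_fun_def)
    then show "(\<Prod>i\<in>UNIV. of_nat (?n i choose k i)) * (g k * h (?n - k)) / (\<Prod>i\<in>UNIV. fact (?n i)) =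
        (g k / (\<Prod>i\<in>UNIV. fact (k i))) * (h (?n - k) / (\<Prod>i\<in>UNIV. fact ((?n - k) i)))"
      by (simp add: prod_dividef prod.distrib)
  qed
  finally show ?thesis
    unfolding mfps_nth_mult mfps_nth_Abs by (rule sym)
qed

text \<open>Induction on the number of colours: the vertices of the last colour form a set \<open>S\<close>, and the
  other vertices carry a colouring with one colour less, so that \<open>nth_mult_profile\<close> applies.\<close>
lemma nth_power_profile:
  fixes g :: "('r::finite \<Rightarrow> nat) \<Rightarrow> 'a::field_char_0" and U :: "('r \<times> 'b) set"
  assumes U: "finite U"
  shows "mfps_nth (Abs_mfps (\<lambda>m. g m / (\<Prod>i\<in>UNIV. fact (m i))) ^ q) (profile U) =
    (\<Sum>c\<in>U \<rightarrow>\<^sub>E {..<q}. \<Prod>k<q. g (profile {u \<in> U. c u = k})) / (\<Prod>i\<in>UNIV. fact (profile U i))"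
  using U
proof (induction q arbitrary: U)
  case 0
  show ?case
  proof (cases "U = {}")
    case False
    then obtain i a where ia: "(i, a) \<in> U"
      by (metis ex_in_conv surj_pair)
    then have "profile U i \<noteq> 0"
      using 0 by (auto simp: profile_def card_eq_0_iff finite_Image)
    then have "profile U \<noteq> (\<lambda>i. 0)" by metis
    moreover have "U \<rightarrow>\<^sub>E {..<0 :: nat} = {}"
      using ia by (auto simp: PiE_eq_empty_iff)
    ultimately show ?thesis
      by (simp only: power_0 mfps_nth_1 sum.empty if_False div_0)
  qed (simp add: mfps_nth_1 profile_def)
next
  case (Suc q)
  let ?F = "Abs_mfps (\<lambda>m. g m / (\<Prod>i\<in>UNIV. fact (m i)))"
  define h where "h m = mfps_nth (?F ^ q) m * (\<Prod>i\<in>UNIV. fact (m i))" for m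
  have "?F ^ q = Abs_mfps (\<lambda>m. h m / (\<Prod>i\<in>UNIV. fact (m i)))"
    by (rule mfps_eqI) (simp add: h_def)
  then have "mfps_nth (?F ^ Suc q) (profile U) * (\<Prod>i\<in>UNIV. fact (profile U i)) =
      (\<Sum>S\<in>Pow U. g (profile S) * h (profile (U - S)))"
    by (simp add: nth_mult_profile Suc.prems)
  also have "\<dots> = (\<Sum>S\<in>Pow U. \<Sum>c\<in>(U - S) \<rightarrow>\<^sub>E {..<q}.
      g (profile S) * (\<Prod>k<q. g (profile {u \<in> U - S. c u = k})))"
    using Suc.prems by (intro sum.cong refl) (simp add: h_def Suc.IH sum_distrib_left)
  also have "\<dots> = (\<Sum>(S, c)\<in>(SIGMA S:Pow U. (U - S) \<rightarrow>\<^sub>E {..<q}).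
      g (profile S) * (\<Prod>k<q. g (profile {u \<in> U - S. c u = k})))"
    using Suc.prems by (intro sum.Sigma) (auto intro: finite_PiE)
  also have "\<dots> = (\<Sum>c\<in>U \<rightarrow>\<^sub>E {..<Suc q}. \<Prod>k<Suc q. g (profile {u \<in> U. c u = k}))"
  proof (rule sum.reindex_bij_witness[where
        i = "\<lambda>c. ({u \<in> U. c u = q}, restrict c {u \<in> U. c u \<noteq> q})" and
        j = "\<lambda>(S, c). \<lambda>u\<in>U. if u \<in> S then q else c u"])
    fix p assume p: "p \<in> (SIGMA S:Pow U. (U - S) \<rightarrow>\<^sub>E {..<q})"
    obtain S c where Sc: "p = (S, c)" "S \<subseteq> U" "c \<in> (U - S) \<rightarrow>\<^sub>E {..<q}"
      using p by auto
    have lt: "c u < q" if "u \<in> U" "u \<notin> S" for u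
      using Sc(3) that by auto
    let ?c = "\<lambda>u\<in>U. if u \<in> S then q else c u"
    have S: "{u \<in> U. ?c u = q} = S"
      using Sc(2) lt by (auto split: if_splits)
    have "restrict ?c {u \<in> U. ?c u \<noteq> q} = c"
    proof
      fix u
      show "restrict ?c {u \<in> U. ?c u \<noteq> q} u = c u"
        using lt[of u] PiE_arb[OF Sc(3), of u] by auto
    qed
    with S show "(case (case p of (S, c) \<Rightarrow> \<lambda>u\<in>U. if u \<in> S then q else c u) of
        c \<Rightarrow> ({u \<in> U. c u = q}, restrict c {u \<in> U. c u \<noteq> q})) = p"
      by (simp add: Sc(1))
    show "(case p of (S, c) \<Rightarrow> \<lambda>u\<in>U. if u \<in> S then q else c u) \<in> U \<rightarrow>\<^sub>E {..<Suc q}"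
      using lt by (auto simp: Sc(1) less_Suc_eq)
    have "{u \<in> U. ?c u = k} = {u \<in> U - S. c u = k}" if "k < q" for k
      using that by auto
    then have "(\<Prod>k<q. g (profile {u \<in> U. ?c u = k})) = (\<Prod>k<q. g (profile {u \<in> U - S. c u = k}))"
      by (intro prod.cong refl) simp
    with S show "(\<Prod>k<Suc q. g (profile {u \<in> U.
          (case p of (S, c) \<Rightarrow> \<lambda>u\<in>U. if u \<in> S then q else c u) u = k})) =
        (case p of (S, c) \<Rightarrow> g (profile S) * (\<Prod>k<q. g (profile {u \<in> U - S. c u = k})))"
      by (simp only: Sc(1) prod.lessThan_Suc prod.case mult.commute)
  next
    fix c assume c: "c \<in> U \<rightarrow>\<^sub>E {..<Suc q}"
    show "(case ({u \<in> U. c u = q}, restrict c {u \<in> U. c u \<noteq> q}) of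
        (S, c) \<Rightarrow> \<lambda>u\<in>U. if u \<in> S then q else c u) = c"
    proof
      fix u
      show "(case ({u \<in> U. c u = q}, restrict c {u \<in> U. c u \<noteq> q}) of
          (S, c) \<Rightarrow> \<lambda>u\<in>U. if u \<in> S then q else c u) u = c u"
        using PiE_arb[OF c, of u] by simp
    qed
    have "U - {u \<in> U. c u = q} = {u \<in> U. c u \<noteq> q}" by auto
    moreover have "c u < q" if "u \<in> U" "c u \<noteq> q" for u
      using PiE_mem[OF c that(1)] that(2) by simp
    ultimately show "({u \<in> U. c u = q}, restrict c {u \<in> U. c u \<noteq> q}) \<in> (SIGMA S:Pow U. (U - S) \<rightarrow>\<^sub>E {..<q})"
      by simp
  qed
  finally show ?case
    by (simp add: field_simps)
qed


section \<open>Complete multipartite graphs\<close>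

lemma verts_weighted_multipartite: "verts (weighted_multipartite l n) = (SIGMA i:UNIV. {..<n i})"
  by (auto simp: weighted_multipartite_def)

lemma finite_multigraph_weighted_multipartite:
  fixes l :: "'r::{finite,linorder} \<Rightarrow> 'r \<Rightarrow> nat"
  shows "finite_multigraph (weighted_multipartite l n)"
proof -
  have "edges (weighted_multipartite l n) \<subseteq>
      (\<lambda>((i, j), a, b, k). ((i, a), (j, b), k)) `
        (SIGMA ij:UNIV. {..<n (fst ij)} \<times> {..<n (snd ij)} \<times> {..<l (fst ij) (snd ij)})"
    by (force simp: weighted_multipartite_def image_iff)
  then have "finite (edges (weighted_multipartite l n))"
    by (rule finite_subset) (auto intro!: finite_imageI finite_SigmaI)
  then show ?thesis
    unfolding finite_multigraph_def verts_weighted_multipartite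
    by (auto simp: weighted_multipartite_def)
qed

text \<open>A monochromatic edge is given by its colour, its pair of parts, an end point of that
  colour in each of them, and its number among the parallel edges.\<close>
lemma card_constant_on_edges_weighted_multipartite:
  fixes l :: "'r::{finite,linorder} \<Rightarrow> 'r \<Rightarrow> nat" and n :: "'r \<Rightarrow> nat" and q :: nat
  defines "G \<equiv> weighted_multipartite l n"
  assumes c: "c \<in> verts G \<rightarrow>\<^sub>E {..<q}"
  defines "m \<equiv> \<lambda>k. profile {u \<in> verts G. c u = k}"
  shows "card (constant_on_edges G c) = (\<Sum>k<q. \<Sum>(i, j) | i < j. l i j * m k i * m k j)"
proof -
  define X where "X k i = {u \<in> verts G. c u = k} `` {i}" for k i
  have fin: "finite (X k i)" for k i
    using finite_multigraph_weighted_multipartite[of l n]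
    by (auto simp: X_def G_def finite_multigraph_def intro: finite_Image)
  let ?S = "SIGMA k:{..<q}. SIGMA ij:{(i, j). i < j}.
    X k (fst ij) \<times> X k (snd ij) \<times> {..<l (fst ij) (snd ij)}"
  let ?f = "\<lambda>(k, (i, j), a, b, t). ((i, a), (j, b), t)"
  have "constant_on_edges G c = ?f ` ?S"
  proof (intro equalityI subsetI)
    fix e assume e: "e \<in> constant_on_edges G c"
    then obtain i a j b t where ij: "e = ((i, a), (j, b), t)" "i < j" "a < n i" "b < n j" "t < l i j"
      by (auto simp: constant_on_edges_def G_def weighted_multipartite_def)
    have "c (i, a) = c (j, b)"
      using e by (rule constant_on_edgesD) (simp_all add: ij G_def weighted_multipartite_def)
    moreover have "c (i, a) < q"
      using c ij by (auto simp: G_def verts_weighted_multipartite)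
    ultimately have "(c (i, a), (i, j), a, b, t) \<in> ?S"
      using ij by (auto simp: X_def G_def verts_weighted_multipartite)
    then show "e \<in> ?f ` ?S"
      by (rule rev_image_eqI) (simp add: ij)
  next
    fix e assume "e \<in> ?f ` ?S"
    then show "e \<in> constant_on_edges G c"
      by (auto simp: X_def constant_on_edges_def G_def weighted_multipartite_def)
  qed
  moreover have "inj_on ?f ?S"
    by (auto simp: inj_on_def X_def)
  ultimately have "card (constant_on_edges G c) = card ?S"
    by (simp add: card_image)
  also have "\<dots> = (\<Sum>k<q. card (SIGMA ij:{(i, j). i < j}.
      X k (fst ij) \<times> X k (snd ij) \<times> {..<l (fst ij) (snd ij)}))"
    by (rule card_SigmaI) (auto intro!: finite_SigmaI fin)
  also have "\<dots> = (\<Sum>k<q. \<Sum>ij\<in>{(i, j). i < j}.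
      card (X k (fst ij) \<times> X k (snd ij) \<times> {..<l (fst ij) (snd ij)}))"
    by (intro sum.cong[OF refl] card_SigmaI) (auto intro!: finite_SigmaI fin)
  also have "\<dots> = (\<Sum>k<q. \<Sum>ij\<in>{(i, j). i < j}. m k (fst ij) * (m k (snd ij) * l (fst ij) (snd ij)))"
    by (simp add: card_cartesian_product m_def profile_def flip: X_def)
  finally show ?thesis
    by (simp add: case_prod_unfold ac_simps)
qed

theorem theorem4p3:
  fixes l :: "'r::{finite,linorder} \<Rightarrow> 'r \<Rightarrow> nat"
    and x y :: "'a::field_char_0"
  assumes "card (UNIV :: 'r set) \<ge> 2"
    and "y \<noteq> 1"
  shows "1 + Abs_mfps (\<lambda>n. if n = (\<lambda>i. 0) then 0 else
        (x - 1) ^ num_components (weighted_multipartite l n) (edges (weighted_multipartite l n)) *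
        Tutte (weighted_multipartite l n) x y / (\<Prod>i\<in>UNIV. fact (n i)))
    = mfps_powr
        (Abs_mfps (\<lambda>m. y ^ (\<Sum>(i, j) | i < j. l i j * m i * m j) *
          (y - 1) powi (- int (\<Sum>i\<in>UNIV. m i)) / (\<Prod>i\<in>UNIV. fact (m i))))
        ((x - 1) * (y - 1))"
    (is "?lhs = mfps_powr ?F _")
proof (rule mfps_eqI)
  fix n :: "'r \<Rightarrow> nat"
  define G where "G = weighted_multipartite l n"
  \<comment> \<open>The coefficient as a function of \<open>q\<close>, with \<open>y\<close> kept fixed; this separates \<open>q\<close> from \<open>x\<close>.\<close>
  define Z where "Z c = (\<Sum>A\<in>Pow (edges G). c ^ num_components G A * (y - 1) ^ card A)
      / (y - 1) ^ card (verts G) / (\<Prod>i\<in>UNIV. fact (n i))" for c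
  define g where "g m = y ^ (\<Sum>(i, j) | i < j. l i j * m i * m j) *
      (y - 1) powi (- int (\<Sum>i\<in>UNIV. m i))" for m
  have G: "finite_multigraph G"
    unfolding G_def by (rule finite_multigraph_weighted_multipartite)
  then have fin: "finite (verts G)"
    by (simp add: finite_multigraph_def)
  have F0: "mfps_nth ?F (\<lambda>i. 0) = 1"
    by simp
  have profile_G: "profile (verts G) = n"
  proof
    fix i
    have "verts G `` {i} = {..<n i}"
      by (auto simp: G_def verts_weighted_multipartite)
    then show "profile (verts G) i = n i"
      by (simp add: profile_def)
  qed

  \<comment> \<open>The natural exponents: both sides are the sum over all colourings with \<open>q\<close> colours.\<close>
  have "Z (of_nat q) = mfps_nth (mfps_powr ?F (of_nat q)) n" for q
  proof -
    have "(\<Prod>k<q. g (profile {u \<in> verts G. c u = k})) =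
        y ^ card (constant_on_edges G c) / (y - 1) ^ card (verts G)"
      if c: "c \<in> verts G \<rightarrow>\<^sub>E {..<q}" for c
    proof -
      have "(\<Sum>k<q. card {u \<in> verts G. c u = k}) = card (verts G)"
        using c fin sum.group[of "verts G" "{..<q}" c "\<lambda>_. 1 :: nat"] by auto
      moreover have "g (profile {u \<in> verts G. c u = k}) =
          y ^ (\<Sum>(i, j) | i < j. l i j * profile {u \<in> verts G. c u = k} i * profile {u \<in> verts G. c u = k} j)
          / (y - 1) ^ card {u \<in> verts G. c u = k}" for k
        using fin by (simp add: g_def sum_profile power_int_minus divide_inverse flip: of_nat_sum)
      ultimately show ?thesis
        using card_constant_on_edges_weighted_multipartite[of c l n q] c
        by (simp add: prod_dividef flip: power_sum G_def)
    qed
    then have "mfps_nth (?F ^ q) n = (\<Sum>c\<in>verts G \<rightarrow>\<^sub>E {..<q}.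
        y ^ card (constant_on_edges G c) / (y - 1) ^ card (verts G)) / (\<Prod>i\<in>UNIV. fact (n i))"
      using nth_power_profile[OF fin, of g q] by (simp add: g_def profile_G)
    also have "\<dots> = Z (of_nat q)"
      using Fortuin_Kasteleyn[OF G, of "{..<q}" "y - 1"]
      by (simp add: Z_def sum_divide_distrib)
    finally show ?thesis
      unfolding mfps_powr_of_nat[OF F0] by (rule sym)
  qed
  moreover have "polynomial_function Z"
    unfolding Z_def divide_inverse
    by (intro polynomial_function_mult polynomial_function_sum polynomial_function_power
        polynomial_function_ident polynomial_function_const)
  ultimately have "Z = (\<lambda>c. mfps_nth (mfps_powr ?F c) n)"
    by (intro polynomial_function_eqI polynomial_function_nth_powr F0)

  moreover have "mfps_nth ?lhs n = Z ((x - 1) * (y - 1))"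
  \<comment> \<open>For the empty graph \<open>Z\<close> is constantly 1, which is the separate summand of the series.\<close>
  proof (cases "n = (\<lambda>i. 0)")
    case True
    then have "verts G = {}" "edges G = {}"
      by (auto simp: G_def weighted_multipartite_def)
    with True show ?thesis
      by (simp add: Z_def mfps_nth_add mfps_nth_1 num_components_empty)
  next
    case False
    then show ?thesis
      using Tutte_eq_cluster_sum[OF G \<open>y \<noteq> 1\<close>, of x]
      by (simp add: Z_def mfps_nth_add mfps_nth_1 flip: G_def)
  qed
  ultimately show "mfps_nth ?lhs n = mfps_nth (mfps_powr ?F ((x - 1) * (y - 1))) n"
    by simp
qed

end
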